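(* Let $k\ge 0$ be an integer and let $C_{4k+3}$ denote the cycle on $4k+3$ vertices. If $G$ is a finite connected graph which satisfies the odd two-pebbling property, then $$f(C_{4k+3}\times G)\leq f(C_{4k+3})\,f(G).$$
   Context: All graphs are finite, simple and connected. A distribution of pebbles on a graph assigns to each vertex a nonnegative integer number of pebbles. A pebbling move removes two pebbles from one vertex and places one pebble on an adjacent vertex. The pebbling number $f(G)$ is the least integer $p$ such that, from every distribution of $p$ pebbles on the vertices of $G$ and for every target vertex $v$ of $G$, it is possible by a (possibly empty) sequence of pebbling moves to place at least one pebble on $v$. A graph $G$ satisfies the odd two-pebbling property if, for every distribution of $p$ pebbles on $G$ in which exactly $r$ vertices carry an odd number of pebbles and $p>2f(G)-r$, and for every vertex $v$ of $G$, it is possible by a sequence of pebbling moves to have at least two pebbles on $v$. The Cartesian product $G\times H$ has vertex set $V(G)\times V(H)$; its edges are the pairs $\{(a,v),(b,v)\}$ with $\{a,b\}\in E(G)$, $v\in V(H)$, and the pairs $\{(u,x),(u,y)\}$ with $u\in V(G)$, $\{x,y\}\in E(H)$. *)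

theory Defs
  imports Graph_Theory.Graph_Theory
begin

text \<open>
  Finite simple graphs are the library's \<open>pair_graph\<close>s: finite, loop-free digraphs given by a
  symmetric set of arcs, so that each undirected edge \<open>{u, v}\<close> is the pair of arcs
  \<open>(u, v)\<close>, \<open>(v, u)\<close>.
\<close>

text \<open>
  A distribution on \<open>G\<close> is any function \<open>D :: 'a \<Rightarrow> nat\<close>; only its values on the vertices of
  \<open>G\<close> matter, and moves along arcs of \<open>G\<close> neither read nor change the others.
\<close>

definition pebble_count :: "'a pair_pre_digraph \<Rightarrow> ('a \<Rightarrow> nat) \<Rightarrow> nat" where
  "pebble_count G D = (\<Sum>v\<in>pverts G. D v)"

definition odd_count :: "'a pair_pre_digraph \<Rightarrow> ('a \<Rightarrow> nat) \<Rightarrow> nat" where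
  "odd_count G D = card {v \<in> pverts G. odd (D v)}"

definition pebbling_move :: "'a pair_pre_digraph \<Rightarrow> ('a \<Rightarrow> nat) \<Rightarrow> ('a \<Rightarrow> nat) \<Rightarrow> bool" where
  "pebbling_move G D D' \<longleftrightarrow>
     (\<exists>u v. (u, v) \<in> parcs G \<and> 2 \<le> D u \<and> D' = D(u := D u - 2, v := D v + 1))"

definition can_reach :: "'a pair_pre_digraph \<Rightarrow> ('a \<Rightarrow> nat) \<Rightarrow> nat \<Rightarrow> 'a \<Rightarrow> bool" where
  "can_reach G D m v \<longleftrightarrow> (\<exists>D'. (pebbling_move G)\<^sup>*\<^sup>* D D' \<and> m \<le> D' v)"

definition pebbling_number :: "'a pair_pre_digraph \<Rightarrow> nat" where
  "pebbling_number G =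
     (LEAST p. \<forall>D. pebble_count G D = p \<longrightarrow> (\<forall>v\<in>pverts G. can_reach G D 1 v))"

text \<open>The inequality is over the integers, since \<open>2 f(G) - r\<close> is not truncated at \<open>0\<close>.\<close>

definition odd_two_pebbling :: "'a pair_pre_digraph \<Rightarrow> bool" where
  "odd_two_pebbling G \<longleftrightarrow>
     (\<forall>D. int (pebble_count G D) > 2 * int (pebbling_number G) - int (odd_count G D) \<longrightarrow>
        (\<forall>v\<in>pverts G. can_reach G D 2 v))"

text \<open>For \<open>n \<ge> 3\<close> this is the cycle \<open>C\<^sub>n\<close>.\<close>

definition cycle_graph :: "nat \<Rightarrow> nat pair_pre_digraph" where
  "cycle_graph n =
     \<lparr>pverts = {..<n},
      parcs = {(i, j). i < n \<and> j < n \<and> (j = (i + 1) mod n \<or> i = (j + 1) mod n)}\<rparr>"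

definition cartesian_product ::
    "'a pair_pre_digraph \<Rightarrow> 'b pair_pre_digraph \<Rightarrow> ('a \<times> 'b) pair_pre_digraph" where
  "cartesian_product G H =
     \<lparr>pverts = pverts G \<times> pverts H,
      parcs = {((a, v), (b, v)) | a b v. (a, b) \<in> parcs G \<and> v \<in> pverts H}
            \<union> {((u, x), (u, y)) | u x y. u \<in> pverts G \<and> (x, y) \<in> parcs H}\<rparr>"

end

theory Submission
  imports Defs "HOL-Library.Function_Algebras"
begin

text \<open>
  Let \<open>m = 2 * n + 1 = 4 * k + 3\<close> and \<open>f = f(G)\<close>. Since \<open>f(C\<^sub>m) \<ge> (2 ^ (n + 2) + 1) / 3\<close>, it suffices
  to solve every distribution of \<open>(2 ^ (n + 2) + 1) / 3 * f\<close> pebbles. The vertices of the cycle other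
  than the target \<open>x\<close> form two paths \<open>a\<^sub>1, \<dots>, a\<^sub>n\<close> and \<open>b\<^sub>1, \<dots>, b\<^sub>n\<close> leading away from \<open>x\<close>, with \<open>a\<^sub>n\<close>
  and \<open>b\<^sub>n\<close> adjacent. A copy of \<open>G\<close> carrying \<open>p\<close> pebbles, \<open>r\<close> of its vertices being odd, can pass
  \<open>(p - r) / 2\<close> pebbles on to a neighbouring copy, and puts \<open>2 * t\<close> pebbles on a prescribed vertex as
  soon as \<open>(p + r) / 2 > t * f\<close>. So few odd vertices make passing on efficient, while many odd vertices
  make concentrating efficient.

  If the target cannot be reached, two strategies fail on each side. The first passes \<open>b\<^sub>n\<close> on to
  \<open>a\<^sub>n\<close> and then everything along the path towards \<open>x\<close>. The second concentrates two pebbles in \<open>b\<^sub>n\<close>,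
  using up its odd vertices, passes everything on to \<open>a\<^sub>n\<close>, and then carries a single concentrated
  pebble down to \<open>a\<^sub>1\<close>: in each copy another single pebble is concentrated at the cost of \<open>f\<close> pebbles
  that include the odd ones, so that the rest can be passed on without loss. Adding the four resulting
  inequalities makes the contributions of the odd vertices cancel and contradicts the number of
  pebbles. If \<open>a\<^sub>n\<close> or \<open>b\<^sub>n\<close> carries too few pebbles for the second strategy, cruder estimates suffice.
\<close>

section \<open>Distributions yielding other distributions\<close>

text \<open>Asking only for domination, and only on vertices, permits discarding surplus pebbles.
  The relation becomes transitive and compatible with sums, so parts of a distribution can be
  treated separately.\<close>

definition yields :: "'a pair_pre_digraph \<Rightarrow> ('a \<Rightarrow> nat) \<Rightarrow> ('a \<Rightarrow> nat) \<Rightarrow> bool" where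
  "yields G D E \<longleftrightarrow> (\<exists>D'. (pebbling_move G)\<^sup>*\<^sup>* D D' \<and> (\<forall>x\<in>pverts G. E x \<le> D' x))"

definition pile :: "'a \<Rightarrow> nat \<Rightarrow> 'a \<Rightarrow> nat" where
  "pile v m = (\<lambda>x. if x = v then m else 0)"

definition slice :: "'b \<Rightarrow> ('a \<Rightarrow> nat) \<Rightarrow> 'b \<times> 'a \<Rightarrow> nat" where
  "slice x E = (\<lambda>(y, u). if y = x then E u else 0)"

definition half :: "('a \<Rightarrow> nat) \<Rightarrow> 'a \<Rightarrow> nat" where
  "half D = (\<lambda>x. D x div 2)"

text \<open>
  For \<open>p\<close> pebbles with \<open>r\<close> odd vertices, \<open>half D\<close> has \<open>(p - r) / 2\<close> and \<open>half_up D\<close> has \<open>(p + r) / 2\<close>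
  pebbles, so that \<open>p > 2 f(G) - r\<close> says that \<open>half_up D\<close> has more than \<open>f(G)\<close> pebbles.
\<close>

definition half_up :: "('a \<Rightarrow> nat) \<Rightarrow> 'a \<Rightarrow> nat" where
  "half_up D = (\<lambda>x. (D x + 1) div 2)"

lemma sum_fun_apply: "(\<Sum>i\<in>A. F i) x = (\<Sum>i\<in>A. F i x)"
  for F :: "'i \<Rightarrow> 'a \<Rightarrow> nat"
  by (induction A rule: infinite_finite_induct) auto

lemma pile_add: "pile v (m + n) = pile v m + pile v n"
  by (auto simp: pile_def)

lemma slice_add: "slice x (E + F) = slice x E + slice x F"
  by (auto simp: slice_def)

lemma slice_pile: "slice x (pile v m) = pile (x, v) m"
  by (auto simp: slice_def pile_def)


lemma half_half_le: "(half D + half D) x \<le> D x"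
  by (simp add: half_def)

lemma yields_mono: "(\<And>x. x \<in> pverts G \<Longrightarrow> E x \<le> D x) \<Longrightarrow> yields G D E"
  unfolding yields_def by blast

lemma yields_refl: "yields G D D"
  by (simp add: yields_mono)

text \<open>The same moves are replayed while the surplus lies idle; the update at each vertex is
  monotone.\<close>

lemma moves_dominated:
  assumes "pair_wf_digraph G" "(pebbling_move G)\<^sup>*\<^sup>* D D'" "\<forall>x\<in>pverts G. D x \<le> E x"
  shows "\<exists>E'. (pebbling_move G)\<^sup>*\<^sup>* E E' \<and> (\<forall>x\<in>pverts G. D' x \<le> E' x)"
  using assms(2,3)
proof (induction rule: rtranclp_induct)
  case base
  then show ?case by blast
next
  case (step D1 D2)
  then obtain E1 where E1: "(pebbling_move G)\<^sup>*\<^sup>* E E1" "\<forall>x\<in>pverts G. D1 x \<le> E1 x"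
    by blast
  obtain u v where uv: "(u, v) \<in> parcs G" "2 \<le> D1 u" "D2 = D1(u := D1 u - 2, v := D1 v + 1)"
    using step.hyps(2) unfolding pebbling_move_def by blast
  have V: "u \<in> pverts G" "v \<in> pverts G"
    using assms(1) uv(1) by (auto dest: pair_wf_digraph.in_arcsD1 pair_wf_digraph.in_arcsD2)
  define E2 where "E2 = E1(u := E1 u - 2, v := E1 v + 1)"
  have "pebbling_move G E1 E2"
    unfolding pebbling_move_def E2_def using uv V E1(2) le_trans by blast
  moreover have "\<forall>x\<in>pverts G. D2 x \<le> E2 x"
    using E1(2) V unfolding E2_def uv(3) by (simp add: diff_le_mono)
  ultimately show ?case
    using E1(1) by (meson rtranclp.rtrancl_into_rtrancl)
qed

lemma yields_trans [trans]:
  assumes "pair_wf_digraph G" "yields G D E" "yields G E F"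
  shows "yields G D F"
proof -
  obtain D' where D': "(pebbling_move G)\<^sup>*\<^sup>* D D'" "\<forall>x\<in>pverts G. E x \<le> D' x"
    using assms(2) unfolding yields_def by blast
  obtain E' where E': "(pebbling_move G)\<^sup>*\<^sup>* E E'" "\<forall>x\<in>pverts G. F x \<le> E' x"
    using assms(3) unfolding yields_def by blast
  obtain D'' where "(pebbling_move G)\<^sup>*\<^sup>* D' D''" "\<forall>x\<in>pverts G. E' x \<le> D'' x"
    using moves_dominated[OF assms(1) E'(1) D'(2)] by blast
  then show ?thesis
    unfolding yields_def using D'(1) E'(2) by (meson le_trans rtranclp_trans)
qed

lemma moves_add:
  assumes "(pebbling_move G)\<^sup>*\<^sup>* D D'"
  shows "(pebbling_move G)\<^sup>*\<^sup>* (D + F) (D' + F)"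
  using assms
proof (induction rule: rtranclp_induct)
  case base
  then show ?case by blast
next
  case (step D1 D2)
  obtain u v where uv: "(u, v) \<in> parcs G" "2 \<le> D1 u" "D2 = D1(u := D1 u - 2, v := D1 v + 1)"
    using step.hyps(2) unfolding pebbling_move_def by blast
  have "D2 + F = (D1 + F)(u := (D1 + F) u - 2, v := (D1 + F) v + 1)"
    using uv(2) unfolding uv(3) by (auto simp: fun_eq_iff)
  then have "pebbling_move G (D1 + F) (D2 + F)"
    unfolding pebbling_move_def using uv(1,2) by (metis plus_fun_apply trans_le_add1)
  then show ?case
    using step.IH by (meson rtranclp.rtrancl_into_rtrancl)
qed

lemma yields_add_right: "yields G D E \<Longrightarrow> yields G (D + F) (E + F)"
  unfolding yields_def using moves_add[of G D _ F] by fastforce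

lemma yields_add:
  assumes "pair_wf_digraph G" "yields G A B" "yields G C D"
  shows "yields G (A + C) (B + D)"
proof -
  have "yields G (A + C) (B + C)"
    using assms(2) by (rule yields_add_right)
  also have "yields G (C + B) (D + B)"
    using assms(3) by (rule yields_add_right)
  ultimately show ?thesis
    using assms(1) by (simp add: add.commute yields_trans)
qed

lemma yields_sum:
  assumes "pair_wf_digraph G" "\<And>i. i \<in> I \<Longrightarrow> yields G (A i) (B i)"
  shows "yields G (\<Sum>i\<in>I. A i) (\<Sum>i\<in>I. B i)"
  using assms(2)
  by (induction I rule: infinite_finite_induct) (auto simp: yields_refl yields_add[OF assms(1)])

lemma yields_arc:
  assumes "pair_wf_digraph G" "(u, v) \<in> parcs G"
  shows "yields G (pile u (m + m)) (pile v m)"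
proof (induction m)
  case 0
  show ?case by (rule yields_mono) (simp add: pile_def)
next
  case (Suc m)
  have "pebbling_move G (pile u 2) ((pile u 2)(u := pile u 2 u - 2, v := pile u 2 v + 1))"
    unfolding pebbling_move_def using assms(2) by (intro exI[of _ u] exI[of _ v]) (simp add: pile_def)
  then have "yields G (pile u 2) (pile v 1)"
    unfolding yields_def by (metis (mono_tags, lifting) fun_upd_same le_add2 nle_le pile_def r_into_rtranclp zero_le)
  from yields_add[OF assms(1) this Suc.IH] show ?case
    by (simp flip: pile_add)
qed

lemma can_reach_iff_yields:
  assumes "v \<in> pverts G"
  shows "can_reach G D m v \<longleftrightarrow> yields G D (pile v m)"
  using assms unfolding can_reach_def yields_def pile_def by auto

lemma ex_subdistribution:
  fixes D :: "'a \<Rightarrow> nat"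
  assumes "m \<le> sum D A"
  obtains E where "\<And>x. E x \<le> D x" "sum E A = m"
proof -
  have "\<exists>E. (\<forall>x. E x \<le> D x) \<and> sum E A = m"
    using assms
  proof (induction m)
    case 0
    then show ?case by (intro exI[of _ "\<lambda>_. 0"]) simp
  next
    case (Suc m)
    then obtain E where E: "\<forall>x. E x \<le> D x" "sum E A = m" by auto
    have fin: "finite A" using Suc.prems by (metis Suc_le_D sum.infinite nat.distinct(1))
    obtain x where x: "x \<in> A" "E x < D x"
      using Suc.prems E(2) by (metis Suc_n_not_le_n linorder_not_le sum_mono order_trans)
    have "sum (E(x := Suc (E x))) A = Suc m"
      using x(1) fin E(2) by (simp add: sum.remove[of A x] sum.remove[of A x E])
    then show ?case
      using E(1) x by (intro exI[of _ "E(x := Suc (E x))"]) auto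
  qed
  then show thesis using that by blast
qed


section \<open>Counting pebbles and their halves\<close>

lemma pebble_count_add: "pebble_count G (D + E) = pebble_count G D + pebble_count G E"
  by (simp add: pebble_count_def sum.distrib)

lemma pebble_count_mono: "(\<And>x. x \<in> pverts G \<Longrightarrow> D x \<le> E x) \<Longrightarrow> pebble_count G D \<le> pebble_count G E"
  by (simp add: pebble_count_def sum_mono)

lemma pebble_count_half: "pebble_count G D = pebble_count G (half D) + pebble_count G (half_up D)"
  unfolding pebble_count_def half_def half_up_def sum.distrib[symmetric]
  by (rule sum.cong) presburger+

lemma odd_count_half:
  assumes "finite (pverts G)"
  shows "pebble_count G (half_up D) = pebble_count G (half D) + odd_count G D"
proof -
  have "odd_count G D = (\<Sum>x\<in>pverts G. D x mod 2)"
    unfolding odd_count_def using assms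
    by (simp add: mod_2_eq_odd of_bool_def flip: sum.inter_filter)
  moreover have "(n + 1) div 2 = n div 2 + n mod 2" for n :: nat
    by presburger
  ultimately show ?thesis
    by (simp add: pebble_count_def half_def half_up_def sum.distrib)
qed

section \<open>The pebbling number and odd two-pebbling\<close>

locale strong_digraph = pair_fin_digraph +
  assumes reachable: "u \<in> pverts G \<Longrightarrow> v \<in> pverts G \<Longrightarrow> (u, v) \<in> (parcs G)\<^sup>*"
begin

lemma yields_power:
  assumes "(u, v) \<in> (parcs G)\<^sup>*"
  shows "\<exists>k. yields G (pile u (2 ^ k)) (pile v 1)"
  using assms
proof (induction rule: converse_rtrancl_induct)
  case base
  show ?case by (rule exI[of _ 0]) (simp add: yields_refl)
next
  case (step u w)
  then obtain k where "yields G (pile w (2 ^ k)) (pile v 1)" by blast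
  then have "yields G (pile u (2 ^ k + 2 ^ k)) (pile v 1)"
    using yields_arc[OF pair_wf_digraph_axioms step.hyps(1)] yields_trans[OF pair_wf_digraph_axioms] by blast
  then show ?case
    by (intro exI[of _ "Suc k"]) (simp add: mult_2)
qed

text \<open>Without such a \<open>p\<close> the \<open>LEAST\<close> in the pebbling number would
  carry no information. By pigeonhole some vertex has \<open>K\<close> pebbles, and
  \<open>K\<close>, a sum over all pairs of vertices, is at least every power needed.\<close>

lemma ex_solvable:
  "\<exists>p. \<forall>D. pebble_count G D = p \<longrightarrow> (\<forall>v\<in>pverts G. can_reach G D 1 v)"
proof -
  have "\<forall>e\<in>pverts G \<times> pverts G. \<exists>k. yields G (pile (fst e) (2 ^ k)) (pile (snd e) 1)"
    using yields_power reachable by auto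
  then obtain k where k: "yields G (pile u (2 ^ k (u, v))) (pile v 1)"
    if "u \<in> pverts G" "v \<in> pverts G" for u v
    by (metis (no_types, lifting) SigmaI bchoice fst_conv snd_conv)
  define K where "K = (\<Sum>e\<in>pverts G \<times> pverts G. 2 ^ k e :: nat)"
  have K: "2 ^ k (u, v) \<le> K" if "u \<in> pverts G" "v \<in> pverts G" for u v
    unfolding K_def using that pair_finite_verts by (intro member_le_sum) auto
  show ?thesis
  proof (intro exI[of _ "card (pverts G) * K + 1"] allI impI ballI)
    fix D v assume D: "pebble_count G D = card (pverts G) * K + 1" and v: "v \<in> pverts G"
    obtain u where u: "u \<in> pverts G" "K \<le> D u"
      using D sum_bounded_above[of "pverts G" D K] unfolding pebble_count_def
      by (metis Suc_eq_plus1 nat_le_linear not_less_eq_eq of_nat_id)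
    have "yields G D (pile u (2 ^ k (u, v)))"
      using u(2) K[OF u(1) v] by (intro yields_mono) (auto simp: pile_def)
    then show "can_reach G D 1 v"
      unfolding can_reach_iff_yields[OF v]
      using k[OF u(1) v] yields_trans[OF pair_wf_digraph_axioms] by blast
  qed
qed

lemma pebbling_number_yields:
  assumes "pebbling_number G \<le> pebble_count G D" "v \<in> pverts G"
  shows "yields G D (pile v 1)"
proof -
  obtain E where E: "\<And>x. E x \<le> D x" "pebble_count G E = pebbling_number G"
    using ex_subdistribution assms(1) unfolding pebble_count_def by metis
  have "\<forall>D. pebble_count G D = pebbling_number G \<longrightarrow> (\<forall>v\<in>pverts G. can_reach G D 1 v)"
    unfolding pebbling_number_def by (rule LeastI_ex[OF ex_solvable])
  then have "yields G E (pile v 1)"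
    using E(2) assms(2) by (simp add: can_reach_iff_yields)
  then show ?thesis
    using E(1) yields_mono yields_trans[OF pair_wf_digraph_axioms] by metis
qed

text \<open>From one pebble on every vertex but \<open>v\<close> no move is possible. This serves to
  bound the number of odd vertices.\<close>

lemma card_le_pebbling_number:
  "card (pverts G) \<le> pebbling_number G"
proof (rule ccontr)
  assume *: "\<not> card (pverts G) \<le> pebbling_number G"
  then obtain v where v: "v \<in> pverts G"
    by fastforce
  define D where "D = (\<lambda>x. if x = v then 0 else 1 :: nat)"
  have "pebble_count G D = card (pverts G - {v})"
    unfolding pebble_count_def D_def using pair_finite_verts v by (simp add: sum.remove)
  then have "yields G D (pile v 1)"
    using * v by (intro pebbling_number_yields) (auto simp: card_Diff_singleton)
  moreover have "D' = D" if "(pebbling_move G)\<^sup>*\<^sup>* D D'" for D'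
    using that by (cases rule: converse_rtranclpE) (auto simp: pebbling_move_def D_def split: if_splits)
  ultimately show False
    using v unfolding yields_def pile_def D_def by fastforce
qed

lemma odd_count_le: "odd_count G D \<le> pebbling_number G"
  using card_mono[OF pair_finite_verts, of "{x \<in> pverts G. odd (D x)}"] card_le_pebbling_number
  unfolding odd_count_def by fastforce

end

locale odd_two_pebbling_graph = strong_digraph +
  assumes odd_two_pebbling: "odd_two_pebbling G"
begin

abbreviation f where "f \<equiv> pebbling_number G"
abbreviation total where "total \<equiv> pebble_count G"

section \<open>Splitting and extracting pebbles within one copy\<close>

lemma total_half_up: "total (half D) \<le> total (half_up D)" "total (half_up D) \<le> total (half D) + f"
  using odd_count_half[OF pair_finite_verts, of D] odd_count_le[of D] by auto

lemma yields_two: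
  assumes "f < total (half_up D)" "v \<in> pverts G"
  shows "yields G D (pile v 2)"
proof -
  have "int (total D) > 2 * int f - int (odd_count G D)"
    using assms(1) pebble_count_half[of G D] odd_count_half[OF pair_finite_verts, of D] by linarith
  then show ?thesis
    using odd_two_pebbling assms(2) unfolding odd_two_pebbling_def by (simp add: can_reach_iff_yields)
qed

text \<open>Removing pairs of pebbles from single vertices keeps all parities, so each pair lowers
  the total of \<open>half_up\<close> by exactly one.\<close>

lemma split_evenly:
  assumes "m \<le> total (half D)"
  obtains E R where "D = E + (R + R)" "total R = m" "total E + 2 * m = total D"
    "total (half_up E) + m = total (half_up D)"
proof -
  obtain R where R: "\<And>x. R x \<le> half D x" "total R = m"
    using ex_subdistribution assms unfolding pebble_count_def by metis
  define E where "E = D - (R + R)"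
  have le: "R x + R x \<le> D x" for x
    using R(1)[of x] unfolding half_def by linarith
  have D: "D = E + (R + R)"
    unfolding E_def by (auto simp: fun_eq_iff le)
  have "half_up E + R = half_up D"
    using D by (auto simp: fun_eq_iff half_up_def)
  with D R(2) that show thesis
    by (metis pebble_count_add mult_2)
qed

text \<open>
  What remains beside the extracted pebbles is even everywhere, because the odd vertices (at most
  \<open>f\<close> of them) can all contribute to the extraction.
\<close>

lemma extract_one:
  assumes "f \<le> total D" "v \<in> pverts G"
  obtains R where "yields G D (pile v 1 + (R + R))" "total R = (total D - f) div 2"
proof -
  have "(total D - f) div 2 \<le> total (half D)"
    using total_half_up[of D] pebble_count_half[of G D] by linarith
  then obtain E R where R: "D = E + (R + R)" "total R = (total D - f) div 2"
    "total E + 2 * ((total D - f) div 2) = total D"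
    using split_evenly by blast
  have "f \<le> total E"
    using R(3) assms(1) by linarith
  then show thesis
    using that R(1,2) pebbling_number_yields assms(2) yields_add_right by metis
qed

text \<open>Pairs are removed until the total of \<open>half_up\<close> is \<open>f + 1\<close>,
  where odd two-pebbling still applies. Enough pairs exist because at most \<open>f\<close> vertices
  are odd.\<close>

lemma extract_two:
  assumes "f < total (half_up D)" "v \<in> pverts G"
  obtains R where "yields G D (pile v 2 + (R + R))" "total R + f + 1 = total (half_up D)"
proof -
  have "total (half_up D) - (f + 1) \<le> total (half D)"
    using total_half_up[of D] by linarith
  then obtain E R where R: "D = E + (R + R)" "total R = total (half_up D) - (f + 1)"
    "total (half_up E) + (total (half_up D) - (f + 1)) = total (half_up D)"
    using split_evenly by blast
  have "f < total (half_up E)" "total R + f + 1 = total (half_up D)"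
    using R(2,3) assms(1) by linarith+
  then show thesis
    using that R(1) yields_two assms(2) yields_add_right by metis
qed

text \<open>Each induction step splits off two equal parts of \<open>f\<close> pebbles, each worth
  one pebble on \<open>v\<close>, and lowers the total of \<open>half_up\<close> by
  \<open>f\<close>. Odd two-pebbling supplies the last two.\<close>

lemma yields_many:
  assumes "t * f < total (half_up D)" "t \<ge> 1" "v \<in> pverts G"
  shows "yields G D (pile v (2 * t))"
  using assms(2,1)
proof (induction t arbitrary: D rule: nat_induct_at_least)
  case base
  then show ?case using yields_two[of D v] assms(3) by simp
next
  case (Suc t)
  have "f + f \<le> Suc t * f"
    using Suc.hyps by simp
  then have "f \<le> total (half D)"
    using Suc.prems total_half_up(2)[of D] by linarith
  then obtain E R where R: "D = E + (R + R)" "total R = f" "total (half_up E) + f = total (half_up D)"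
    using split_evenly by blast
  have "yields G R (pile v 1)"
    using R(2) assms(3) by (intro pebbling_number_yields) simp_all
  moreover have "yields G E (pile v (2 * t))"
    using Suc.IH[of E] Suc.prems R(3) by simp
  ultimately have "yields G D (pile v (2 * t) + (pile v 1 + pile v 1))"
    unfolding R(1) by (intro yields_add pair_wf_digraph_axioms)
  then show ?case
    by (simp flip: pile_add)
qed

end


section \<open>Walks of copies of a graph\<close>

locale pebbling_product = odd_two_pebbling_graph G + H: pair_wf_digraph H
  for G :: "'a pair_pre_digraph" and H :: "'b pair_pre_digraph" +
  fixes v assumes v: "v \<in> pverts G"
begin

abbreviation P where "P \<equiv> cartesian_product H G"

sublocale P: pair_wf_digraph P
  by unfold_locales
    (auto simp: cartesian_product_def dest: H.in_arcsD1 H.in_arcsD2 in_arcsD1 in_arcsD2)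

lemmas P_trans [trans] = yields_trans[OF P.pair_wf_digraph_axioms]
  and P_add = yields_add[OF P.pair_wf_digraph_axioms]

section \<open>Moves within a copy and between neighbouring copies\<close>

lemma yields_slice:
  assumes "x \<in> pverts H" "yields G E F"
  shows "yields P (slice x E) (slice x F)"
proof -
  have move: "pebbling_move P (slice x A) (slice x B)" if AB: "pebbling_move G A B" for A B
  proof -
    obtain u w where uw: "(u, w) \<in> parcs G" "2 \<le> A u" "B = A(u := A u - 2, w := A w + 1)"
      using AB unfolding pebbling_move_def by blast
    have "((x, u), (x, w)) \<in> parcs P"
      using assms(1) uw(1) by (simp add: cartesian_product_def)
    moreover have "slice x B = (slice x A)((x, u) := slice x A (x, u) - 2, (x, w) := slice x A (x, w) + 1)"
      unfolding uw(3) by (auto simp: slice_def fun_eq_iff)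
    moreover have "2 \<le> slice x A (x, u)"
      using uw(2) by (simp add: slice_def)
    ultimately show ?thesis
      unfolding pebbling_move_def by blast
  qed
  have "(pebbling_move P)\<^sup>*\<^sup>* (slice x E) (slice x E')" if "(pebbling_move G)\<^sup>*\<^sup>* E E'" for E'
    using that by (induction rule: rtranclp_induct) (auto intro: move rtranclp.rtrancl_into_rtrancl)
  then show ?thesis
    using assms(2) unfolding yields_def
    by (fastforce simp: slice_def cartesian_product_def)
qed

text \<open>The pebbles at each \<open>(x, u)\<close> move separately to \<open>(y, u)\<close>;
  doubling makes every count even, so none is stranded.\<close>

lemma yields_slice_arc:
  assumes "(x, y) \<in> parcs H"
  shows "yields P (slice x (E + E)) (slice y E)"
proof -
  have piles: "(\<Sum>u\<in>pverts G. pile (z, u) (F u)) p = slice z F p" if "p \<in> pverts P" for z F p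
    using that pair_finite_verts
    by (auto simp: sum_fun_apply pile_def slice_def cartesian_product_def)
  have "yields P (slice x (E + E)) (\<Sum>u\<in>pverts G. pile (x, u) (E u + E u))"
    using piles[of _ x "E + E"] by (intro yields_mono) simp
  also have "yields P (\<Sum>u\<in>pverts G. pile (x, u) (E u + E u)) (\<Sum>u\<in>pverts G. pile (y, u) (E u))"
    using assms
    by (intro yields_sum yields_arc P.pair_wf_digraph_axioms) (simp add: cartesian_product_def)
  also have "yields P (\<Sum>u\<in>pverts G. pile (y, u) (E u)) (slice y E)"
    using piles[of _ y E] by (intro yields_mono) simp
  finally show ?thesis .
qed

text \<open>Indices count the steps left to the target's copy \<open>\<pi> 0\<close>, hence the arcs
  run from \<open>Suc i\<close> to \<open>i\<close>.\<close>

definition walk :: "(nat \<Rightarrow> 'b) \<Rightarrow> nat \<Rightarrow> bool" where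
  "walk \<pi> n \<longleftrightarrow> \<pi> 0 \<in> pverts H \<and> (\<forall>i<n. (\<pi> (Suc i), \<pi> i) \<in> parcs H)"

abbreviation stack :: "(nat \<Rightarrow> 'b) \<Rightarrow> (nat \<Rightarrow> 'a \<Rightarrow> nat) \<Rightarrow> nat \<Rightarrow> 'b \<times> 'a \<Rightarrow> nat" where
  "stack \<pi> E n \<equiv> (\<Sum>i\<le>n. slice (\<pi> i) (E i))"

lemma walk_Suc: "walk \<pi> (Suc n) \<longleftrightarrow> walk \<pi> n \<and> (\<pi> (Suc n), \<pi> n) \<in> parcs H"
  by (auto simp: walk_def less_Suc_eq)

lemma walk_in_verts: "walk \<pi> n \<Longrightarrow> \<pi> n \<in> pverts H"
  by (cases n) (auto simp: walk_def dest: H.in_arcsD1)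

lemma stack_upd: "stack \<pi> (E(n := E n + F)) n = stack \<pi> E n + slice (\<pi> n) F"
proof -
  have "(\<Sum>i<n. slice (\<pi> i) ((E(n := E n + F)) i)) = (\<Sum>i<n. slice (\<pi> i) (E i))"
    by (rule sum.cong) auto
  then show ?thesis
    by (simp add: lessThan_Suc_atMost[symmetric] slice_add add.assoc)
qed

lemma total_upd: "n \<in> I \<Longrightarrow> finite I \<Longrightarrow>
    (\<Sum>i\<in>I. total ((E(n := E n + F)) i)) = (\<Sum>i\<in>I. total (E i)) + total F"
  by (simp add: sum.remove[of I n] pebble_count_add)

lemma walk_pile: "walk \<pi> n \<Longrightarrow> yields P (pile (\<pi> n, v) (2 ^ n)) (pile (\<pi> 0, v) 1)"
proof (induction n)
  case 0
  show ?case by (simp add: yields_refl)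
next
  case (Suc n)
  have "((\<pi> (Suc n), v), (\<pi> n, v)) \<in> parcs P"
    using Suc.prems v by (simp add: walk_Suc cartesian_product_def)
  from yields_arc[OF P.pair_wf_digraph_axioms this, of "2 ^ n"]
  have "yields P (pile (\<pi> (Suc n), v) (2 ^ Suc n)) (pile (\<pi> n, v) (2 ^ n))"
    by (simp add: mult_2)
  also have "yields P \<dots> (pile (\<pi> 0, v) 1)"
    using Suc by (simp add: walk_Suc)
  finally show ?case .
qed

section \<open>Passing pebbles along a walk\<close>

lemma push:
  assumes "walk \<pi> (Suc n)" "yields P D (stack \<pi> E n + slice (\<pi> (Suc n)) (R + R))"
  shows "yields P D (stack \<pi> (E(n := E n + R)) n)"
proof -
  have "yields P (slice (\<pi> (Suc n)) (R + R)) (slice (\<pi> n) R)"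
    using assms(1) by (simp add: walk_Suc yields_slice_arc)
  with assms(2) show ?thesis
    unfolding stack_upd by (meson P_trans P_add yields_refl)
qed

lemma push_half:
  assumes "walk \<pi> (Suc n)"
  shows "yields P (stack \<pi> E (Suc n)) (stack \<pi> (E(n := E n + half (E (Suc n)))) n)"
  using assms
proof (rule push)
  show "yields P (stack \<pi> E (Suc n)) (stack \<pi> E n + slice (\<pi> (Suc n)) (half (E (Suc n)) + half (E (Suc n))))"
    using half_half_le[of "E (Suc n)"] by (intro yields_mono) (auto simp: slice_def sum_fun_apply)
qed

text \<open>If \<open>half_up\<close> of the last copy exceeds \<open>2 ^ n * f\<close>, that copy
  alone concentrates enough pebbles on \<open>v\<close>. Otherwise passing on its
  \<open>half\<close> loses at most \<open>2 ^ n * f\<close> pebbles, exactly the amount by which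
  the requirement drops.\<close>

lemma stack_reaches:
  assumes "walk \<pi> n" "2 ^ n * f \<le> (\<Sum>i\<le>n. total (E i))"
  shows "yields P (stack \<pi> E n) (pile (\<pi> 0, v) 1)"
  using assms
proof (induction n arbitrary: E)
  case 0
  then show ?case
    using yields_slice pebbling_number_yields v walk_in_verts by (fastforce simp flip: slice_pile)
next
  case (Suc n)
  show ?case
  proof (cases "2 ^ n * f < total (half_up (E (Suc n)))")
    case True
    have "yields P (stack \<pi> E (Suc n)) (slice (\<pi> (Suc n)) (E (Suc n)))"
      by (intro yields_mono) (simp add: sum_fun_apply)
    also have "yields P \<dots> (pile (\<pi> (Suc n), v) (2 ^ Suc n))"
      using yields_many[OF True _ v] yields_slice walk_in_verts[OF Suc.prems(1)]
      by (simp flip: slice_pile)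
    also have "yields P \<dots> (pile (\<pi> 0, v) 1)"
      by (rule walk_pile[OF Suc.prems(1)])
    finally show ?thesis .
  next
    case False
    then have "2 ^ n * f \<le> (\<Sum>i\<le>n. total (E i)) + total (half (E (Suc n)))"
      using Suc.prems(2) pebble_count_half[of G "E (Suc n)"] by simp
    then have "yields P (stack \<pi> (E(n := E n + half (E (Suc n)))) n) (pile (\<pi> 0, v) 1)"
      using Suc.prems(1) by (intro Suc.IH) (simp_all add: total_upd walk_Suc del: fun_upd_apply)
    with push_half[OF Suc.prems(1)] show ?thesis
      by (rule P_trans)
  qed
qed

lemma pile_stack_step:
  assumes "walk \<pi> (Suc n)"
    and "yields P D (pile (\<pi> (Suc n), v) 2 + (stack \<pi> E n + slice (\<pi> (Suc n)) (R + R)))"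
  shows "yields P D (pile (\<pi> n, v) 1 + stack \<pi> (E(n := E n + R)) n)"
proof -
  have "((\<pi> (Suc n), v), (\<pi> n, v)) \<in> parcs P"
    using assms(1) v by (simp add: walk_Suc cartesian_product_def)
  from yields_arc[OF P.pair_wf_digraph_axioms this, of 1]
  have "yields P (pile (\<pi> (Suc n), v) 2) (pile (\<pi> n, v) 1)"
    by (simp add: numeral_2_eq_2)
  from P_add[OF this push[OF assms(1) yields_refl]] show ?thesis
    using assms(2) P_trans by blast
qed

text \<open>A single pebble on \<open>v\<close> travels along. In each copy \<open>f\<close> pebbles
  buy it a companion, the two become one pebble in the next copy, and the rest is even and passes on
  without loss, up to rounding. Copy 0 is not counted.\<close>

lemma pile_stack_reaches:
  assumes "walk \<pi> n" "1 \<le> n" "2 ^ n * f \<le> f + (\<Sum>i=1..n. total (E i))"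
  shows "yields P (pile (\<pi> n, v) 1 + stack \<pi> E n) (pile (\<pi> 0, v) 1)"
  using assms(2,1,3)
proof (induction n arbitrary: E rule: nat_induct_at_least)
  case base
  then have "yields P (slice (\<pi> 1) (E 1)) (pile (\<pi> 1, v) 1)"
    using pebbling_number_yields[of "E 1" v] v walk_in_verts yields_slice
    by (simp flip: slice_pile)
  then have "yields P (pile (\<pi> 1, v) 1 + slice (\<pi> 1) (E 1)) (pile (\<pi> 1, v) (1 + 1))"
    unfolding pile_add by (intro P_add yields_refl)
  also have "yields P \<dots> (pile (\<pi> 0, v) 1)"
    using walk_pile[OF base(1)] by (simp add: numeral_2_eq_2)
  finally have "yields P (pile (\<pi> 1, v) 1 + slice (\<pi> 1) (E 1)) (pile (\<pi> 0, v) 1)" .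
  moreover have "yields P (pile (\<pi> 1, v) 1 + stack \<pi> E 1) (pile (\<pi> 1, v) 1 + slice (\<pi> 1) (E 1))"
    by (rule yields_mono) (simp add: sum_fun_apply)
  ultimately show ?case
    using P_trans by blast
next
  case (Suc n)
  show ?case
    \<comment> \<open>Either the copies \<open>1, \<dots>, n\<close> suffice on their own, or there are the \<open>f\<close> pebbles in copy
      \<open>n + 1\<close> needed for a second pebble on \<open>v\<close>.\<close>
  proof (cases "2 ^ n * f \<le> (\<Sum>i=1..n. total (E i))")
    case True
    have "(\<Sum>i=1..n. total (E i)) \<le> (\<Sum>i\<le>n. total (E i))"
      by (rule sum_mono2) auto
    then have "yields P (stack \<pi> E n) (pile (\<pi> 0, v) 1)"
      using True Suc.prems(1) by (intro stack_reaches) (auto simp: walk_Suc)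
    moreover have "yields P (pile (\<pi> (Suc n), v) 1 + stack \<pi> E (Suc n)) (stack \<pi> E n)"
      by (rule yields_mono) (simp add: sum_fun_apply)
    ultimately show ?thesis
      using P_trans by blast
  next
    case False
    have f2: "2 * f \<le> 2 ^ n * f"
      using power_increasing[OF Suc.hyps, of "2 :: nat"] by simp
    have le: "2 * (2 ^ n * f) \<le> f + (\<Sum>i=1..n. total (E i)) + total (E (Suc n))"
      using Suc.prems(2) by simp
    then have "f \<le> total (E (Suc n))"
      using False f2 by linarith
    then obtain R where R: "yields G (E (Suc n)) (pile v 1 + (R + R))"
      "total R = (total (E (Suc n)) - f) div 2"
      using extract_one v by blast
    have "yields P (slice (\<pi> (Suc n)) (E (Suc n))) (pile (\<pi> (Suc n), v) 1 + slice (\<pi> (Suc n)) (R + R))"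
      using yields_slice[OF walk_in_verts[OF Suc.prems(1)] R(1)] by (simp add: slice_add slice_pile)
    then have "yields P (pile (\<pi> (Suc n), v) 1 + stack \<pi> E n + slice (\<pi> (Suc n)) (E (Suc n)))
      (pile (\<pi> (Suc n), v) 1 + stack \<pi> E n + (pile (\<pi> (Suc n), v) 1 + slice (\<pi> (Suc n)) (R + R)))"
      by (intro P_add yields_refl)
    then have "yields P (pile (\<pi> (Suc n), v) 1 + stack \<pi> E (Suc n))
      (pile (\<pi> (Suc n), v) 2 + (stack \<pi> E n + slice (\<pi> (Suc n)) (R + R)))"
      using pile_add[of "(\<pi> (Suc n), v)" 1 1] by (simp add: add_ac numeral_2_eq_2)
    then have "yields P (pile (\<pi> (Suc n), v) 1 + stack \<pi> E (Suc n))
      (pile (\<pi> n, v) 1 + stack \<pi> (E(n := E n + R)) n)"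
      by (rule pile_stack_step[OF Suc.prems(1)])
    also have "yields P \<dots> (pile (\<pi> 0, v) 1)"
    proof (rule Suc.IH)
      have "2 ^ n * f \<le> f + (\<Sum>i=1..n. total (E i)) + total R"
        using le False R(2) \<open>f \<le> total (E (Suc n))\<close> by linarith
      then show "2 ^ n * f \<le> f + (\<Sum>i=1..n. total ((E(n := E n + R)) i))"
        using Suc.hyps by (simp add: total_upd del: fun_upd_apply)
    qed (use Suc.prems in \<open>simp add: walk_Suc\<close>)
    finally show ?thesis .
  qed
qed


text \<open>Each bound records the failure of one strategy: using copy 0 alone; passing
  \<open>B\<close> on to \<open>A\<close>; passing on \<open>A + half B\<close> as well;
  concentrating two pebbles in \<open>A\<close> (fourth and fifth); concentrating two pebbles in
  \<open>B\<close> (last).\<close>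

lemma unsolvable_walk_bounds:
  assumes walk: "walk \<pi> (Suc (Suc l))"
    and unsolvable: "\<not> yields P (stack \<pi> E (Suc (Suc l))) (pile (\<pi> 0, v) 1)"
  defines "A \<equiv> E (Suc l)" and "B \<equiv> E (Suc (Suc l))" and "W \<equiv> \<Sum>i=1..l. total (E i)"
  shows "total (E 0) < f"
    and "total (E 0) + W + total A + total (half B) < 2 * (2 ^ l * f)"
    and "total (E 0) + W + total (half (A + half B)) < 2 ^ l * f"
    and "l = 0 \<Longrightarrow> total (half_up A) \<le> f"
    and "1 \<le> l \<Longrightarrow> f < total (half_up A) \<Longrightarrow> W + total (half_up A) \<le> 2 ^ l * f"
    and "1 \<le> l \<Longrightarrow> f < total (half_up A) \<Longrightarrow> f < total (half_up B) \<Longrightarrow>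
      2 * W + total A + total (half_up B) \<le> 2 * (2 ^ l * f)"
proof -
  let ?S = "stack \<pi> E (Suc (Suc l))"
  have walk1: "walk \<pi> (Suc l)" and walk0: "walk \<pi> l" and in_V: "\<pi> (Suc (Suc l)) \<in> pverts H" "\<pi> (Suc l) \<in> pverts H"
    using walk walk_in_verts by (auto simp: walk_Suc)
  have no: "\<not> yields P F (pile (\<pi> 0, v) 1)" if "yields P ?S F" for F
    using that unsolvable P_trans by blast
  have sum_split: "(\<Sum>i\<le>l. total (E i)) = total (E 0) + W"
    unfolding W_def by (simp add: atMost_atLeast0 sum.atLeast_Suc_atMost)
  have W_upd: "1 \<le> l \<Longrightarrow> (\<Sum>i=1..l. total ((E(l := E l + R)) i)) = W + total R" for R
    unfolding W_def by (simp add: total_upd del: fun_upd_apply)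

  show "total (E 0) < f"
  proof (rule ccontr)
    assume "\<not> total (E 0) < f"
    then have "yields P (stack \<pi> E 0) (pile (\<pi> 0, v) 1)"
      using walk by (intro stack_reaches) (auto simp: walk_def)
    moreover have "yields P ?S (stack \<pi> E 0)"
      by (rule yields_mono) (simp add: sum.atMost_shift sum_fun_apply)
    ultimately show False
      using no by blast
  qed

  \<comment> \<open>The state after passing \<open>B\<close> on, common to the second and third
    bounds.\<close>
  define E1 where "E1 = E(Suc l := A + half B)"
  have S1: "yields P ?S (stack \<pi> E1 (Suc l))"
    unfolding E1_def A_def B_def by (rule push_half[OF walk])
  have E1: "E1 (Suc l) = A + half B" "(\<Sum>i\<le>l. total (E1 i)) = total (E 0) + W"
    unfolding E1_def sum_split[symmetric] by (simp, intro sum.cong) auto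
  show "total (E 0) + W + total A + total (half B) < 2 * (2 ^ l * f)"
  proof (rule ccontr)
    assume "\<not> ?thesis"
    then have "yields P (stack \<pi> E1 (Suc l)) (pile (\<pi> 0, v) 1)"
      using E1 by (intro stack_reaches[OF walk1]) (simp add: pebble_count_add)
    with no[OF S1] show False ..
  qed
  show "total (E 0) + W + total (half (A + half B)) < 2 ^ l * f"
  proof (rule ccontr)
    assume "\<not> ?thesis"
    then have "yields P (stack \<pi> (E1(l := E1 l + half (E1 (Suc l)))) l) (pile (\<pi> 0, v) 1)"
      using E1 by (intro stack_reaches[OF walk0]) (simp add: total_upd del: fun_upd_apply)
    with push_half[OF walk1] S1 P_trans no show False by blast
  qed

  \<comment> \<open>Here \<open>B\<close> is simply discarded.\<close>
  have two: "\<exists>R. yields P ?S (pile (\<pi> (Suc l), v) 2 + (stack \<pi> E l + slice (\<pi> (Suc l)) (R + R)))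
      \<and> total R + f + 1 = total (half_up A)" if A: "f < total (half_up A)"
  proof -
    obtain R where R: "yields G A (pile v 2 + (R + R))" "total R + f + 1 = total (half_up A)"
      using extract_two[OF A v] by blast
    have "yields P (slice (\<pi> (Suc l)) A) (pile (\<pi> (Suc l), v) 2 + slice (\<pi> (Suc l)) (R + R))"
      using yields_slice[OF in_V(2) R(1)] by (simp add: slice_add slice_pile)
    then have "yields P (stack \<pi> E l + slice (\<pi> (Suc l)) A)
      (stack \<pi> E l + (pile (\<pi> (Suc l), v) 2 + slice (\<pi> (Suc l)) (R + R)))"
      by (intro P_add yields_refl)
    moreover have "yields P ?S (stack \<pi> E l + slice (\<pi> (Suc l)) A)"
      unfolding A_def by (rule yields_mono) simp
    ultimately have "yields P ?S (stack \<pi> E l + (pile (\<pi> (Suc l), v) 2 + slice (\<pi> (Suc l)) (R + R)))"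
      using P_trans by blast
    with R(2) show ?thesis
      by (auto simp: add.left_commute)
  qed
  show "total (half_up A) \<le> f" if "l = 0"
  proof (rule ccontr)
    assume "\<not> ?thesis"
    then obtain R where "yields P ?S (pile (\<pi> (Suc l), v) 2 + (stack \<pi> E l + slice (\<pi> (Suc l)) (R + R)))"
      using two by auto
    then have "yields P ?S (pile (\<pi> 0, v) 1 + stack \<pi> (E(0 := E 0 + R)) 0)"
      using pile_stack_step[OF walk1] that by simp
    moreover have "yields P (pile (\<pi> 0, v) 1 + stack \<pi> (E(0 := E 0 + R)) 0) (pile (\<pi> 0, v) 1)"
      by (rule yields_mono) simp
    ultimately show False
      using no by blast
  qed
  show "W + total (half_up A) \<le> 2 ^ l * f" if l: "1 \<le> l" and A: "f < total (half_up A)"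
  proof (rule ccontr)
    assume *: "\<not> ?thesis"
    obtain R where R: "yields P ?S (pile (\<pi> (Suc l), v) 2 + (stack \<pi> E l + slice (\<pi> (Suc l)) (R + R)))"
      "total R + f + 1 = total (half_up A)"
      using two[OF A] by blast
    from R(2) * have "2 ^ l * f \<le> f + (W + total R)" by linarith
    then have "yields P (pile (\<pi> l, v) 1 + stack \<pi> (E(l := E l + R)) l) (pile (\<pi> 0, v) 1)"
      unfolding W_upd[OF l, symmetric] by (rule pile_stack_reaches[OF walk0 l])
    with pile_stack_step[OF walk1 R(1)] no show False by blast
  qed
  show "2 * W + total A + total (half_up B) \<le> 2 * (2 ^ l * f)"
    if l: "1 \<le> l" and A: "f < total (half_up A)" and B: "f < total (half_up B)"
  proof (rule ccontr)
    assume *: "\<not> ?thesis"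
    obtain R where R: "yields G B (pile v 2 + (R + R))" "total R + f + 1 = total (half_up B)"
      using extract_two[OF B v] by blast
    have "yields P (slice (\<pi> (Suc (Suc l))) B)
      (pile (\<pi> (Suc (Suc l)), v) 2 + slice (\<pi> (Suc (Suc l))) (R + R))"
      using yields_slice[OF in_V(1) R(1)] by (simp add: slice_add slice_pile)
    then have "yields P ?S (stack \<pi> E (Suc l) +
      (pile (\<pi> (Suc (Suc l)), v) 2 + slice (\<pi> (Suc (Suc l))) (R + R)))"
      unfolding B_def sum.atMost_Suc[of _ "Suc l"] by (intro P_add yields_refl)
    then have "yields P ?S (pile (\<pi> (Suc l), v) 1 + stack \<pi> (E(Suc l := E (Suc l) + R)) (Suc l))"
      by (intro pile_stack_step[OF walk]) (simp add: add_ac)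
    then have S2: "yields P ?S (pile (\<pi> (Suc l), v) 1 + stack \<pi> E l + slice (\<pi> (Suc l)) (A + R))"
      unfolding stack_upd by (simp add: slice_add A_def add_ac)
    have "f \<le> total (A + R)"
      using A pebble_count_half[of G A] by (simp add: pebble_count_add)
    \<comment> \<open>One pebble has arrived from \<open>B\<close>; \<open>f\<close> pebbles of
      \<open>A + R\<close> now buy the second, absorbing the odd vertices.\<close>
    then obtain Q where Q: "yields G (A + R) (pile v 1 + (Q + Q))" "total Q = (total (A + R) - f) div 2"
      using extract_one v by blast
    have "yields P (slice (\<pi> (Suc l)) (A + R)) (pile (\<pi> (Suc l), v) 1 + slice (\<pi> (Suc l)) (Q + Q))"
      using yields_slice[OF in_V(2) Q(1)] by (simp add: slice_add slice_pile)
    then have "yields P (pile (\<pi> (Suc l), v) 1 + stack \<pi> E l + slice (\<pi> (Suc l)) (A + R))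
      (pile (\<pi> (Suc l), v) 1 + stack \<pi> E l + (pile (\<pi> (Suc l), v) 1 + slice (\<pi> (Suc l)) (Q + Q)))"
      by (intro P_add yields_refl)
    with S2 have "yields P ?S
      (pile (\<pi> (Suc l), v) 1 + stack \<pi> E l + (pile (\<pi> (Suc l), v) 1 + slice (\<pi> (Suc l)) (Q + Q)))"
      by (rule P_trans)
    then have "yields P ?S (pile (\<pi> (Suc l), v) 2 + (stack \<pi> E l + slice (\<pi> (Suc l)) (Q + Q)))"
      using pile_add[of "(\<pi> (Suc l), v)" 1 1] by (simp add: add_ac numeral_2_eq_2)
    note S3 = pile_stack_step[OF walk1 this]
    have "2 ^ l * f \<le> f + (W + total Q)"
      using * R(2) Q(2) \<open>f \<le> total (A + R)\<close> by (simp add: pebble_count_add)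
    then have "yields P (pile (\<pi> l, v) 1 + stack \<pi> (E(l := E l + Q)) l) (pile (\<pi> 0, v) 1)"
      unfolding W_upd[OF l, symmetric] by (rule pile_stack_reaches[OF walk0 l])
    with S3 no show False by blast
  qed
qed

text \<open>The walks approach the target from its two sides and end in the same two copies in
  opposite order, so the bounds for both apply with \<open>A\<close> and \<open>B\<close> exchanged.
  The count is \<open>(2 ^ (n + 2) + 1) / 3 * f\<close> for \<open>n = l + 1\<close>, cleared of its
  denominator.\<close>

lemma two_walks_reach:
  assumes walk: "walk \<pi> (Suc (Suc l))" "walk \<rho> (Suc (Suc l))" "\<rho> 0 = \<pi> 0"
    and E: "yields P D (stack \<pi> E (Suc (Suc l)))" and F: "yields P D (stack \<rho> F (Suc (Suc l)))"
    and common: "F 0 = E 0" "F (Suc l) = E (Suc (Suc l))" "F (Suc (Suc l)) = E (Suc l)"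
    and l: "l \<noteq> 1"
    and count: "8 * (2 ^ l * f) + f \<le> 3 * (total (E 0) + (\<Sum>i=1..l. total (E i)) + total (E (Suc l))
      + total (F (Suc l)) + (\<Sum>i=1..l. total (F i)))"
  shows "yields P D (pile (\<pi> 0, v) 1)"
proof (rule ccontr)
  assume no: "\<not> ?thesis"
  define A where "A = E (Suc l)"
  define B where "B = F (Suc l)"
  define X where "X = (\<Sum>i=1..l. total (E i))"
  define Y where "Y = (\<Sum>i=1..l. total (F i))"
  define p where "p = total (E 0)"
  define Z where "Z = 2 ^ l * f"
  define hx where "hx = total (half (A + half B))"
  define hy where "hy = total (half (B + half A))"
  define ta where "ta = total (half_up A)"
  define tb where "tb = total (half_up B)"
  define ha where "ha = total (half A)"
  define hb where "hb = total (half B)"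
  have "\<not> yields P (stack \<pi> E (Suc (Suc l))) (pile (\<pi> 0, v) 1)"
    using no E P_trans by blast
  note x = unsolvable_walk_bounds[OF walk(1) this, unfolded common(2)[symmetric],
      folded A_def B_def, folded X_def p_def Z_def hx_def ta_def hb_def tb_def]
  have "\<not> yields P (stack \<rho> F (Suc (Suc l))) (pile (\<rho> 0, v) 1)"
    using no F walk(3) P_trans by metis
  note y = unsolvable_walk_bounds[OF walk(2) this, unfolded common(1,3),
      folded A_def B_def, folded Y_def p_def Z_def hy_def tb_def ha_def ta_def]
  have A: "total A = ha + ta" and B: "total B = hb + tb"
    unfolding ha_def ta_def hb_def tb_def by (rule pebble_count_half)+
  \<comment> \<open>At most \<open>f\<close> vertices of \<open>A + half B\<close>, and of
    \<open>B + half A\<close>, are odd.\<close>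
  have hx: "ha + ta + hb \<le> 2 * hx + f" and hy: "hb + tb + ha \<le> 2 * hy + f"
    using total_half_up(2)[of "A + half B"] pebble_count_half[of G "A + half B"]
      total_half_up(2)[of "B + half A"] pebble_count_half[of G "B + half A"]
    unfolding pebble_count_add A B hx_def hy_def hb_def[symmetric] ha_def[symmetric] by linarith+
  have hxy: "ha \<le> hx" "hb \<le> hy"
    unfolding ha_def hx_def hb_def hy_def by (auto intro!: pebble_count_mono simp: half_def)
  have N: "8 * Z + f \<le> 3 * p + 3 * X + 3 * (total A) + 3 * (total B) + 3 * Y"
    using count by (simp add: A_def B_def X_def Y_def p_def Z_def)
  show False
  proof (cases "l = 0")
    case True
    then have "X = 0" "Y = 0" "Z = f"
      by (simp_all add: X_def Y_def Z_def)
    with x(2) x(4)[OF True] y(2) y(4)[OF True] N A B show False by linarith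
  next
    case False
    \<comment> \<open>Case 1 below needs \<open>5 * f <= 2 * Z\<close> and cases 2 and 3 need
      \<open>4 * f <= Z\<close>; \<open>l = 1\<close> would only give
      \<open>Z = 2 * f\<close>.\<close>
    with l have "2 ^ 2 \<le> (2 :: nat) ^ l"
      by (intro power_increasing) auto
    then have Z: "4 * f \<le> Z"
      unfolding Z_def by simp
    have l1: "1 \<le> l" using False by simp
    note x56 = x(5,6)[OF l1] and y56 = y(5,6)[OF l1]
    consider "ta \<le> f" "tb \<le> f" | "ta \<le> f" "f < tb" | "f < ta" "tb \<le> f" | "f < ta" "f < tb"
      by linarith
    then show False
    proof cases
      case 1
      with x(3) y(3) hxy N Z A B show False by linarith
    next
      \<comment> \<open>Weight 3 on the third bound for \<open>\<pi>\<close> and 3/2 on the second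
        and fifth for \<open>\<rho>\<close> would force \<open>Z < 4 * f\<close>.\<close>
      case 2
      with y(2) y56(1) x(3) hx N Z A B show False by linarith
    next
      case 3
      with x(2) x56(1) y(3) hy N Z A B show False by linarith
    next
      \<comment> \<open>In the sum of the four long bounds \<open>ha + ta\<close> and
        \<open>hb + tb\<close> recombine to full totals, giving coefficient 3 everywhere except at
        \<open>p\<close>, which is completed by \<open>p < f\<close>.\<close>
      case 4
      with x(1,2) y(2) x56(2) y56(2) N A B show False by linarith
    qed
  qed
qed

lemma stack_le:
  assumes "inj_on \<pi> {..n}"
  shows "stack \<pi> (\<lambda>i u. D (\<pi> i, u)) n q \<le> D q"
proof (cases "fst q \<in> \<pi> ` {..n}")
  case True
  then obtain j where j: "j \<le> n" "fst q = \<pi> j" by auto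
  have "stack \<pi> (\<lambda>i u. D (\<pi> i, u)) n q = (\<Sum>i\<le>n. if i = j then D q else 0)"
    unfolding sum_fun_apply using assms j
    by (intro sum.cong) (auto simp: slice_def inj_on_eq_iff split: prod.splits)
  with j(1) show ?thesis by simp
next
  case False
  then have "stack \<pi> (\<lambda>i u. D (\<pi> i, u)) n q = 0"
    unfolding sum_fun_apply by (intro sum.neutral) (auto simp: slice_def split: prod.splits)
  then show ?thesis by simp
qed

end

section \<open>The pebbling number of a cycle\<close>

lemma pebbling_move_weight:
  assumes "finite V" "u \<in> V" "v \<in> V" "u \<noteq> v" "2 \<le> D u" "w v \<le> 2 * w u"
  shows "(\<Sum>x\<in>V. (D(u := D u - 2, v := D v + 1)) x * w x) \<le> (\<Sum>x\<in>V. D x * w x :: nat)"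
proof -
  let ?D' = "D(u := D u - 2, v := D v + 1)"
  \<comment> \<open>Adding the two removed pebbles back avoids truncated subtraction.\<close>
  have "?D' + pile u 2 = D + pile v 1"
    using assms(4,5) by (auto simp: pile_def fun_eq_iff)
  then have "(\<Sum>x\<in>V. (?D' + pile u 2) x * w x) = (\<Sum>x\<in>V. (D + pile v 1) x * w x)"
    by simp
  moreover have "(\<Sum>x\<in>V. pile z m x * w x) = m * w z" if "z \<in> V" for z m
    using that assms(1) by (simp add: pile_def if_distrib[of "\<lambda>t. t * _"] cong: if_cong)
  ultimately have "(\<Sum>x\<in>V. ?D' x * w x) + 2 * w u = (\<Sum>x\<in>V. D x * w x) + w v"
    using assms(2,3) by (simp add: distrib_right sum.distrib)
  with assms(6) show ?thesis by linarith
qed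

lemma strong_digraph_cycle_graph:
  assumes "0 < m"
  shows "strong_digraph (cycle_graph m)"
proof
  fix u v
  assume uv: "u \<in> pverts (cycle_graph m)" "v \<in> pverts (cycle_graph m)"
  have "(u, (u + d) mod m) \<in> (parcs (cycle_graph m))\<^sup>*" for d
  proof (induction d)
    case 0
    then show ?case using uv by (simp add: cycle_graph_def)
  next
    case (Suc d)
    have "((u + d) mod m, (u + Suc d) mod m) \<in> parcs (cycle_graph m)"
      using assms by (simp add: cycle_graph_def mod_Suc_eq)
    with Suc show ?case by (rule rtrancl_into_rtrancl)
  qed
  \<comment> \<open>Adding \<open>m\<close> first keeps the subtraction exact and vanishes modulo
    \<open>m\<close>.\<close>
  from this[of "v + m - u"] show "(u, v) \<in> (parcs (cycle_graph m))\<^sup>*"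
    using uv by (simp add: cycle_graph_def)
next
  show "finite (parcs (cycle_graph m))"
    by (rule finite_subset[of _ "{..<m} \<times> {..<m}"]) (auto simp: cycle_graph_def)
qed (auto simp: cycle_graph_def)


text \<open>
  The vertex \<open>0\<close> cannot be reached from \<open>(2 ^ (2 * k + 2) - 1) / 3\<close> pebbles on each of the two
  opposite vertices \<open>2 * k + 1\<close> and \<open>2 * k + 2\<close>. Let \<open>W\<^sub>1\<close> and \<open>W\<^sub>2\<close> be the weights of the pebbles on
  the two sides, a pebble at distance \<open>i\<close> from \<open>0\<close> having weight \<open>2 ^ (2 * k + 1 - i)\<close>. No move
  increases \<open>2 * W\<^sub>1 + W\<^sub>2\<close> or \<open>W\<^sub>1 + 2 * W\<^sub>2\<close>, and reaching \<open>0\<close> would need one of them to be at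
  least \<open>2 ^ (2 * k + 2)\<close>.
\<close>

lemma pebbling_number_cycle_graph_ge:
  "8 * 4 ^ k + 1 \<le> 3 * pebbling_number (cycle_graph (4 * k + 3))"
proof -
  define m where "m = 4 * k + 3"
  define h :: nat where "h = 2 * k + 1"
  \<comment> \<open>\<open>w1\<close> and \<open>w2\<close> give
    \<open>2 * W\<^sub>1 + W\<^sub>2\<close> and \<open>W\<^sub>1 + 2 * W\<^sub>2\<close>. A vertex
    \<open>j > h\<close> has distance \<open>2 * h + 1 - j\<close> from 0, hence the exponent
    \<open>j - h - 1\<close>. Vertex 0 may weigh 0 because \<open>safe\<close> keeps it
    empty.\<close>
  define w1 :: "nat \<Rightarrow> nat"
    where "w1 j = (if j = 0 then 0 else if j \<le> h then 2 * 2 ^ (h - j) else 2 ^ (j - h - 1))" for j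
  define w2 :: "nat \<Rightarrow> nat"
    where "w2 j = (if j = 0 then 0 else if j \<le> h then 2 ^ (h - j) else 2 * 2 ^ (j - h - 1))" for j
  define safe where "safe D \<longleftrightarrow> D 0 = 0
    \<and> (\<Sum>x<m. D x * w1 x) < 2 ^ (h + 1) \<and> (\<Sum>x<m. D x * w2 x) < 2 ^ (h + 1)" for D
  have m: "m = 2 * h + 1" "0 < h"
    by (simp_all add: m_def h_def)
  have w_step: "w1 (Suc j) \<le> 2 * w1 j" "w1 j \<le> 2 * w1 (Suc j)" "w2 (Suc j) \<le> 2 * w2 j" "w2 j \<le> 2 * w2 (Suc j)"
    if "0 < j" for j
  proof -
    \<comment> \<open>On either side weights change by a factor 2 per step. Across the edge from
      \<open>h\<close> to \<open>Suc h\<close> they are 2 and 1, or 1 and 2.\<close>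
    consider i where "h = Suc j + i" | "j = h" | i where "j = Suc h + i"
      by (metis Suc_leI le_iff_add linorder_neqE_nat)
    then show "w1 (Suc j) \<le> 2 * w1 j" "w1 j \<le> 2 * w1 (Suc j)" "w2 (Suc j) \<le> 2 * w2 j" "w2 j \<le> 2 * w2 (Suc j)"
      using that by (cases; simp add: w1_def w2_def)+
  qed
  have safe_move: "safe D'" if D: "safe D" "pebbling_move (cycle_graph m) D D'" for D D'
  proof -
    obtain u v where uv: "u < m" "v < m" "v = (u + 1) mod m \<or> u = (v + 1) mod m" "2 \<le> D u"
      "D' = D(u := D u - 2, v := D v + 1)"
      using D(2) unfolding pebbling_move_def cycle_graph_def by auto
    have u: "u \<noteq> 0"
      using D(1) uv(4) unfolding safe_def by (metis not_numeral_le_zero)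
    have D_le: "2 * w u \<le> (\<Sum>x<m. D x * w x)" for w
    proof -
      have "2 * w u \<le> D u * w u"
        using uv(4) by simp
      also have "\<dots> \<le> (\<Sum>x<m. D x * w x)"
        using uv(1) by (intro member_le_sum) auto
      finally show ?thesis .
    qed
    have v: "v \<noteq> 0"
    proof
      assume "v = 0"
      then have "u = 1 \<or> u = 2 * h"
        using uv(1,3) m by (auto simp: mod_Suc split: if_splits)
      \<comment> \<open>Two pebbles on a neighbour of 0 already weigh \<open>2 ^ (h + 1)\<close>:
        under \<open>w1\<close> at 1, under \<open>w2\<close> at \<open>2 * h\<close>.\<close>
      then show False
      proof
        assume "u = 1"
        then show False
          using D(1) D_le[of w1] m(2) unfolding safe_def w1_def by (cases h) auto
      next
        assume "u = 2 * h"
        then show False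
          using D(1) D_le[of w2] m(2) unfolding safe_def w2_def by (cases h) auto
      qed
    qed
    have step: "v = Suc u \<or> u = Suc v"
      using uv(1-3) u v by (auto simp: mod_Suc split: if_splits)
    have "w1 v \<le> 2 * w1 u" "w2 v \<le> 2 * w2 u"
      using step u v w_step by auto
    then have "(\<Sum>x<m. D' x * w1 x) \<le> (\<Sum>x<m. D x * w1 x)" "(\<Sum>x<m. D' x * w2 x) \<le> (\<Sum>x<m. D x * w2 x)"
      unfolding uv(5) using uv(1,2,4) step by (intro pebbling_move_weight; auto)+
    moreover have "D' 0 = 0"
      using D(1) u v unfolding uv(5) safe_def by simp
    ultimately show ?thesis
      using D(1) unfolding safe_def by linarith
  qed
  have "\<exists>L::nat. 3 * L + 1 = 4 * 4 ^ k"
  proof (induction k)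
    case (Suc k)
    then obtain L :: nat where L: "3 * L + 1 = 4 * 4 ^ k" ..
    have "3 * (4 * L + 1) + 1 = 4 * (3 * L + 1)"
      by simp
    also have "\<dots> = 4 * 4 ^ Suc k"
      by (simp only: L power_Suc)
    finally show ?case ..
  qed (simp add: exI[of _ 1])
  then obtain L :: nat where L: "3 * L + 1 = 4 * 4 ^ k" ..
  define D where "D = pile h L + pile (Suc h) L"
  have pow: "2 ^ (h + 1) = 3 * L + 1"
    unfolding L by (simp add: h_def power_mult)
  have sum_pile: "(\<Sum>x<m. pile z L x * w x) = L * w z" if "z < m" for z and w :: "nat \<Rightarrow> nat"
    using that by (simp add: pile_def if_distrib[of "\<lambda>t. t * _"] cong: if_cong)
  have sum_D: "(\<Sum>x<m. D x * w x) = L * w h + L * w (Suc h)" for w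
    using sum_pile[of h w] sum_pile[of "Suc h" w] m by (simp add: D_def distrib_right sum.distrib)
  \<comment> \<open>Both weights of \<open>D\<close> are \<open>3 * L\<close>, one below the
    threshold.\<close>
  have safe_D: "safe D"
    unfolding safe_def sum_D pow using m(2) by (simp add: D_def pile_def w1_def w2_def)
  have safe: "safe D'" if "(pebbling_move (cycle_graph m))\<^sup>*\<^sup>* D D'" for D'
    using that by (induction rule: rtranclp_induct) (auto intro: safe_D safe_move)
  interpret C: strong_digraph "cycle_graph m"
    using m by (intro strong_digraph_cycle_graph) simp
  have "pebbling_number (cycle_graph m) > 2 * L"
  proof (rule ccontr)
    assume "\<not> ?thesis"
    moreover have "pebble_count (cycle_graph m) D = 2 * L"
      using sum_D[of "\<lambda>_. 1"] by (simp add: pebble_count_def cycle_graph_def)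
    moreover have V: "0 \<in> pverts (cycle_graph m)"
      using m by (simp add: cycle_graph_def)
    ultimately have "can_reach (cycle_graph m) D 1 0"
      unfolding can_reach_iff_yields[OF V] by (intro C.pebbling_number_yields) simp_all
    then obtain D' where "(pebbling_move (cycle_graph m))\<^sup>*\<^sup>* D D'" "1 \<le> D' 0"
      unfolding can_reach_def by blast
    with safe show False
      unfolding safe_def by fastforce
  qed
  then show ?thesis
    using L unfolding m_def by linarith
qed

section \<open>Products with cycles\<close>

theorem theorem2p3:
  fixes k :: nat and G :: "'a pair_pre_digraph"
  assumes "pair_graph G"
    and "connected (with_proj G)"
    and "odd_two_pebbling G"
  shows "pebbling_number (cartesian_product (cycle_graph (4 * k + 3)) G)
           \<le> pebbling_number (cycle_graph (4 * k + 3)) * pebbling_number G"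
proof -
  define m where "m = 4 * k + 3"
  interpret G: pair_graph G by (rule assms(1))
  have strong: "strongly_connected (with_proj G)"
    using G.symmetric_connected_imp_strongly_connected[OF G.sym_arcs assms(2)] .
  interpret C: strong_digraph "cycle_graph m"
    by (rule strong_digraph_cycle_graph) (simp add: m_def)
  interpret odd_two_pebbling_graph G
  proof
    fix u v assume "u \<in> pverts G" "v \<in> pverts G"
    then show "(u, v) \<in> (parcs G)\<^sup>*"
      using strong reachable_rtranclI[of "with_proj G" u v] by (auto simp: strongly_connected_def)
  qed (rule assms(3))
  have solvable: "can_reach (cartesian_product (cycle_graph m) G) D 1 q"
    if D: "pebble_count (cartesian_product (cycle_graph m) G) D = pebbling_number (cycle_graph m) * f"
      and q: "q \<in> pverts (cartesian_product (cycle_graph m) G)" for D q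
  proof -
    obtain x v where xv: "q = (x, v)" "x < m" "v \<in> pverts G"
      using q by (auto simp: cartesian_product_def cycle_graph_def)
    interpret pebbling_product G "cycle_graph m" v
      by unfold_locales (rule xv(3))
    define \<sigma> where "\<sigma> j = (x + j) mod m" for j
    \<comment> \<open>The walk in the opposite direction; at \<open>i = 0\<close> the index
      \<open>m\<close> wraps round to \<open>\<sigma> 0\<close>.\<close>
    define \<rho> where "\<rho> i = \<sigma> (m - i)" for i
    define E where "E \<pi> i u = D (\<pi> i, u)" for \<pi> :: "nat \<Rightarrow> nat" and i u
    define l where "l = 2 * k"
    have m: "m = 2 * l + 3"
      by (simp add: m_def l_def)
    have \<sigma>: "\<sigma> j = (if x + j < m then x + j else x + j - m)" if "j < m" for j
      using that xv(2) by (simp add: \<sigma>_def le_mod_geq)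
    have \<rho>: "\<rho> i = (if i \<le> x then x - i else x + m - i)" if "i < m" for i
      using that xv(2) by (auto simp: \<rho>_def \<sigma>_def le_mod_geq)
    have E_\<rho>: "E \<rho> i = E \<sigma> (m - i)" for i
      by (simp add: E_def \<rho>_def fun_eq_iff)
    have inj: "inj_on \<sigma> {..<m}" "inj_on \<rho> {..<m}"
      using xv(2) by (auto intro!: inj_onI simp: \<sigma> \<rho> split: if_splits)
    have img: "\<sigma> ` {..<m} = {..<m}"
      using m by (intro endo_inj_surj inj(1)) (auto simp: \<sigma>_def)
    have \<rho>0: "\<rho> 0 = \<sigma> 0"
      by (simp add: \<rho>_def \<sigma>_def)
    have walks: "walk \<sigma> (Suc (Suc l))" "walk \<rho> (Suc (Suc l))"
    proof -
      have arc: "(\<sigma> (Suc j), \<sigma> j) \<in> parcs (cycle_graph m)" "(\<sigma> j, \<sigma> (Suc j)) \<in> parcs (cycle_graph m)"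
        for j
        using m by (simp_all add: \<sigma>_def cycle_graph_def mod_Suc_eq)
      have "\<sigma> j \<in> pverts (cycle_graph m)" for j
        using arc(1) by (rule C.in_arcsD2)
      moreover have "(\<rho> (Suc i), \<rho> i) \<in> parcs (cycle_graph m)" if "i < Suc (Suc l)" for i
      proof -
        have "m - i = Suc (m - Suc i)"
          using that m by simp
        then show ?thesis
          unfolding \<rho>_def using arc(2) by metis
      qed
      ultimately show "walk \<sigma> (Suc (Suc l))" "walk \<rho> (Suc (Suc l))"
        unfolding walk_def \<rho>0 using arc(1) by blast+
    qed
    have "inj_on \<sigma> {..Suc (Suc l)}"
      using m by (intro inj_on_subset[OF inj(1)]) auto
    then have D1: "yields P D (stack \<sigma> (E \<sigma>) (Suc (Suc l)))"
      unfolding E_def by (intro yields_mono stack_le)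
    have "inj_on \<rho> {..Suc (Suc l)}"
      using m by (intro inj_on_subset[OF inj(2)]) auto
    then have D2: "yields P D (stack \<rho> (E \<rho>) (Suc (Suc l)))"
      unfolding E_def by (intro yields_mono stack_le)
    have count: "pebble_count P D = total (E \<sigma> 0) + (\<Sum>i=1..l. total (E \<sigma> i)) + total (E \<sigma> (Suc l))
      + total (E \<rho> (Suc l)) + (\<Sum>i=1..l. total (E \<rho> i))"
    proof -
      have "pebble_count P D = (\<Sum>y<m. total (\<lambda>u. D (y, u)))"
        by (simp add: pebble_count_def cartesian_product_def cycle_graph_def sum.cartesian_product)
      also have "\<dots> = (\<Sum>j<m. total (E \<sigma> j))"
        unfolding E_def using sum.reindex[OF inj(1), of "\<lambda>y. total (\<lambda>u. D (y, u))"] img by (simp add: comp_def)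
      also have "\<dots> = total (E \<sigma> 0) + (\<Sum>j=1..<m. total (E \<sigma> j))"
        using m by (simp add: lessThan_atLeast0 sum.atLeast_Suc_lessThan)
      \<comment> \<open>The three blocks are one side of the cycle, the two copies opposite the
        target, and the other side, which \<open>\<rho>\<close> reads backwards.\<close>
      also have "(\<Sum>j=1..<m. total (E \<sigma> j)) = (\<Sum>j=1..<l+1. total (E \<sigma> j))
          + ((\<Sum>j=l+1..<l+3. total (E \<sigma> j)) + (\<Sum>j=l+3..<m. total (E \<sigma> j)))"
        using m sum.atLeastLessThan_concat[of 1 "l + 1" m "\<lambda>j. total (E \<sigma> j)"]
          sum.atLeastLessThan_concat[of "l + 1" "l + 3" m "\<lambda>j. total (E \<sigma> j)"]
        by (simp del: sum.op_ivl_Suc)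
      also have "(\<Sum>j=l+3..<m. total (E \<sigma> j)) = (\<Sum>i=1..l. total (E \<rho> i))"
        using m by (intro sum.reindex_bij_witness[of _ "\<lambda>i. m - i" "\<lambda>j. m - j"]) (auto simp: E_\<rho>)
      also have "(\<Sum>j=l+1..<l+3. total (E \<sigma> j)) = total (E \<sigma> (Suc l)) + total (E \<rho> (Suc l))"
        using m by (simp add: numeral_3_eq_3 E_\<rho>)
      finally show ?thesis
        by (simp add: atLeastLessThanSuc_atLeastAtMost)
    qed
    have "yields P D (pile (\<sigma> 0, v) 1)"
      using walks \<rho>0 D1 D2
    proof (rule two_walks_reach)
      show "E \<rho> 0 = E \<sigma> 0"
        using \<rho>0 by (simp add: E_def fun_eq_iff)
      show "E \<rho> (Suc l) = E \<sigma> (Suc (Suc l))" "E \<rho> (Suc (Suc l)) = E \<sigma> (Suc l)"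
        by (simp_all add: E_\<rho> m)
      \<comment> \<open>The form \<open>4 * k + 3\<close> of the length makes \<open>l\<close> even,
        excluding the cycle of length 5.\<close>
      show "l \<noteq> 1"
        unfolding l_def by presburger
      have "(8 * 2 ^ l + 1) * f \<le> 3 * pebbling_number (cycle_graph m) * f"
        using pebbling_number_cycle_graph_ge[of k] unfolding m_def l_def
        by (intro mult_le_mono1) (simp add: power_mult)
      then show "8 * (2 ^ l * f) + f \<le> 3 * (total (E \<sigma> 0) + (\<Sum>i=1..l. total (E \<sigma> i)) + total (E \<sigma> (Suc l))
          + total (E \<rho> (Suc l)) + (\<Sum>i=1..l. total (E \<rho> i)))"
        unfolding count[symmetric] D by (simp add: algebra_simps)
    qed
    moreover have "\<sigma> 0 = x"
      using xv(2) by (simp add: \<sigma>_def)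
    ultimately show ?thesis
      using can_reach_iff_yields[OF q] xv(1) by simp
  qed
  show ?thesis
    unfolding pebbling_number_def[of "cartesian_product _ _"] m_def[symmetric]
    by (rule Least_le) (use solvable in blast)
qed

end
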